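(* Let $a,b$ be elements in a JB$^*$-algebra $\mathfrak{J}$, and let $\mathfrak{J}_{a,b}$ denote the JB$^*$-subalgebra of $\mathfrak{J}$ generated by $a$ and $b$. Suppose there is a C$^*$-algebra $A$ containing $\mathfrak{J}_{a,b}$ as a JB$^*$-subalgebra. Assume that $a$ and $b$ operator commute in $\mathfrak{J}$. Then $a$ and $b$ commute as elements of $A$ (i.e. $ab=ba$ in $A$). In particular, if $\mathfrak{J}$ is a JC$^*$-algebra which is a JB$^*$-subalgebra of a C$^*$-algebra $A$, then two elements $a,b\in\mathfrak{J}$ operator commute in $\mathfrak{J}$ if, and only if, they commute in $A$.
   Context: A Jordan algebra is a vector space with a commutative bilinear product $\circ$ satisfying $(a^2\circ b)\circ a=(a\circ b)\circ a^2$. Put $U_a(b)=2(a\circ b)\circ a-a^2\circ b$. A JB$^*$-algebra is a complex Jordan algebra that is a Banach space with $\|a\circ b\|\le\|a\|\|b\|$, equipped with a conjugate-linear involution $*$ with $(a\circ b)^*=a^*\circ b^*$ and $\|U_a(a^* )\|=\|a\|^3$. A JB$^*$-subalgebra is a norm-closed, $*$-invariant Jordan subalgebra. Every C$^*$-algebra is a JB$^*$-algebra with $a\circ b=\frac12(ab+ba)$ and its own norm and involution; "JB$^*$-subalgebra of a C$^*$-algebra $A$" refers to this structure. A JC$^*$-algebra is a JB$^*$-algebra that is a JB$^*$-subalgebra of some C$^*$-algebra. Elements $a,b\in\mathfrak{J}$ operator commute in $\mathfrak{J}$ if $(a\circ c)\circ b=a\circ(c\circ b)$ for every $c\in\mathfrak{J}$.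 The elements $a,b$ are not assumed self-adjoint. *)

theory Defs
  imports "HOL-Analysis.Analysis"
begin

text \<open>
  The type class \<^class>\<open>banach\<close> only knows real scalars, so the complex structure is an explicit
  scalar multiplication extending the real one.
\<close>

locale complex_banach_space = vector_space scaleC
  for scaleC :: "complex \<Rightarrow> 'a::banach \<Rightarrow> 'a" (infixr \<open>*\<^sub>C\<close> 75) +
  assumes scaleC_of_real: "complex_of_real r *\<^sub>C x = r *\<^sub>R x"
    and norm_scaleC: "norm (c *\<^sub>C x) = cmod c * norm x"

definition jordan_U :: "('a::real_vector \<Rightarrow> 'a \<Rightarrow> 'a) \<Rightarrow> 'a \<Rightarrow> 'a \<Rightarrow> 'a" where
  "jordan_U jprod a b = 2 *\<^sub>R jprod (jprod a b) a - jprod (jprod a a) b"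

locale jb_star_algebra = complex_banach_space scaleC
  for scaleC :: "complex \<Rightarrow> 'a::banach \<Rightarrow> 'a" (infixr \<open>*\<^sub>C\<close> 75) +
  fixes jprod :: "'a \<Rightarrow> 'a \<Rightarrow> 'a" (infixl \<open>\<circ>\<^sub>J\<close> 70)
    and star :: "'a \<Rightarrow> 'a"
  assumes jprod_commute: "a \<circ>\<^sub>J b = b \<circ>\<^sub>J a"
    and jprod_add_left: "(a + b) \<circ>\<^sub>J c = a \<circ>\<^sub>J c + b \<circ>\<^sub>J c"
    and jprod_scaleC_left: "(k *\<^sub>C a) \<circ>\<^sub>J b = k *\<^sub>C (a \<circ>\<^sub>J b)"
    and jordan_identity: "((a \<circ>\<^sub>J a) \<circ>\<^sub>J b) \<circ>\<^sub>J a = (a \<circ>\<^sub>J b) \<circ>\<^sub>J (a \<circ>\<^sub>J a)"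
    and norm_jprod: "norm (a \<circ>\<^sub>J b) \<le> norm a * norm b"
    and star_add: "star (a + b) = star a + star b"
    and star_scaleC: "star (k *\<^sub>C a) = cnj k *\<^sub>C star a"
    and star_star: "star (star a) = a"
    and star_jprod: "star (a \<circ>\<^sub>J b) = star a \<circ>\<^sub>J star b"
    and norm_U_star: "norm (jordan_U (\<circ>\<^sub>J) a (star a)) = norm a ^ 3"

definition jb_star_subalgebra ::
  "(complex \<Rightarrow> 'a::banach \<Rightarrow> 'a) \<Rightarrow> ('a \<Rightarrow> 'a \<Rightarrow> 'a) \<Rightarrow> ('a \<Rightarrow> 'a) \<Rightarrow> 'a set \<Rightarrow> bool" where
  "jb_star_subalgebra scaleC jprod star S \<longleftrightarrow>
     module.subspace scaleC S \<and> closed S \<and>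
     (\<forall>x\<in>S. \<forall>y\<in>S. jprod x y \<in> S) \<and> (\<forall>x\<in>S. star x \<in> S)"

definition operator_commute_in ::
  "'a set \<Rightarrow> ('a \<Rightarrow> 'a \<Rightarrow> 'a) \<Rightarrow> 'a \<Rightarrow> 'a \<Rightarrow> bool" where
  "operator_commute_in J jprod a b \<longleftrightarrow>
     (\<forall>c\<in>J. jprod (jprod a c) b = jprod a (jprod c b))"

text \<open>
  The C*-algebras are not assumed to be unital: \<^class>\<open>real_normed_algebra\<close> has no unit element.
\<close>

locale c_star_algebra = complex_banach_space scaleC
  for scaleC :: "complex \<Rightarrow> 'a::{banach, real_normed_algebra} \<Rightarrow> 'a" (infixr \<open>*\<^sub>C\<close> 75) +
  fixes star :: "'a \<Rightarrow> 'a"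
  assumes mult_scaleC_left: "(k *\<^sub>C a) * b = k *\<^sub>C (a * b)"
    and mult_scaleC_right: "a * (k *\<^sub>C b) = k *\<^sub>C (a * b)"
    and star_add: "star (a + b) = star a + star b"
    and star_scaleC: "star (k *\<^sub>C a) = cnj k *\<^sub>C star a"
    and star_star: "star (star a) = a"
    and star_mult: "star (a * b) = star b * star a"
    and norm_star_mult_self: "norm (star a * a) = (norm a)\<^sup>2"

definition jordan_product :: "'a::real_algebra \<Rightarrow> 'a \<Rightarrow> 'a" where
  "jordan_product a b = (1 / 2) *\<^sub>R (a * b + b * a)"

lemma jordan_U_jordan_product: "jordan_U jordan_product a b = a * b * (a::'a::real_algebra)"
  by (simp add: jordan_U_def jordan_product_def algebra_simps scaleR_left_distrib[symmetric])

context c_star_algebra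
begin

lemma star_scaleR: "star (r *\<^sub>R a) = r *\<^sub>R star a"
  using star_scaleC[of "complex_of_real r" a] by (simp add: scaleC_of_real)

lemma norm_le_norm_star: "norm a \<le> norm (star a)"
proof (cases "norm a = 0")
  case False
  have "norm a * norm a \<le> norm (star a) * norm a"
    using norm_mult_ineq[of "star a" a] norm_star_mult_self[of a] by (simp add: power2_eq_square)
  with False show ?thesis by simp
qed simp

lemma norm_star: "norm (star a) = norm a"
  using norm_le_norm_star[of a] norm_le_norm_star[of "star a"] by (simp add: star_star)

lemma norm_mult_star_mult: "norm (a * star a * a) = norm a ^ 3"
proof (cases "norm a = 0")
  case False
  let ?h = "star a * a" and ?b = "a * star a * a"
  have sa: "star ?h = ?h" by (simp add: star_mult star_star)
  have h2: "norm (?h * ?h) = (norm a)\<^sup>2 ^ 2"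
    using norm_star_mult_self[of ?h] by (simp add: sa norm_star_mult_self)
  have "norm (?h * ?h) \<le> norm (star a) * norm ?b"
    using norm_mult_ineq[of "star a" ?b] by (simp add: mult.assoc)
  then have "(norm a)\<^sup>2 ^ 2 \<le> norm a * norm ?b"
    unfolding h2 norm_star .
  then have "norm a * norm a ^ 3 \<le> norm a * norm ?b"
    by (simp add: power2_eq_square power3_eq_cube mult.assoc)
  then have ge: "norm a ^ 3 \<le> norm ?b" using False by simp
  have "norm ?b \<le> norm a * norm ?h"
    using norm_mult_ineq[of a ?h] by (simp add: mult.assoc)
  then have "norm ?b \<le> norm a ^ 3"
    by (simp add: norm_star_mult_self power2_eq_square power3_eq_cube mult.assoc)
  with ge show ?thesis by simp
qed simp

end

sublocale c_star_algebra \<subseteq> jb_star_algebra scaleC jordan_product star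
proof
  fix a b c :: 'a and k :: complex
  show "jordan_product a b = jordan_product b a"
    by (simp add: jordan_product_def add.commute)
  show "jordan_product (a + b) c = jordan_product a c + jordan_product b c"
    by (simp add: jordan_product_def algebra_simps)
  show "jordan_product (scaleC k a) b = scaleC k (jordan_product a b)"
    by (simp add: jordan_product_def mult_scaleC_left mult_scaleC_right scale_right_distrib
        scaleC_of_real[symmetric] mult.commute[of k])
  show "jordan_product (jordan_product (jordan_product a a) b) a
      = jordan_product (jordan_product a b) (jordan_product a a)"
    by (simp add: jordan_product_def algebra_simps)
  have "norm (a * b + b * a) \<le> norm a * norm b + norm b * norm a"
    by (intro norm_triangle_le add_mono norm_mult_ineq)
  then show "norm (jordan_product a b) \<le> norm a * norm b"
    by (simp add: jordan_product_def)
  show "star (a + b) = star a + star b" by (rule star_add)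
  show "star (scaleC k a) = scaleC (cnj k) (star a)" by (rule star_scaleC)
  show "star (star a) = a" by (rule star_star)
  show "star (jordan_product a b) = jordan_product (star a) (star b)"
    by (simp add: jordan_product_def star_scaleR star_add star_mult add.commute)
  show "norm (jordan_U jordan_product a (star a)) = norm a ^ 3"
    by (simp add: jordan_U_jordan_product norm_mult_star_mult)
qed

text \<open>
  ``S is contained in the C*-algebra as a JB*-subalgebra'': since S and the C*-algebra live on
  different types, the inclusion is a map f on S which identifies S, with all of its JB*-structure
  (norm included), with a JB*-subalgebra of the C*-algebra. Nothing is required of f outside S.
\<close>

definition jb_star_inclusion ::
  "(complex \<Rightarrow> 'a::banach \<Rightarrow> 'a) \<Rightarrow> ('a \<Rightarrow> 'a \<Rightarrow> 'a) \<Rightarrow> ('a \<Rightarrow> 'a) \<Rightarrow> 'a set \<Rightarrow>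
   (complex \<Rightarrow> 'b::{banach, real_normed_algebra} \<Rightarrow> 'b) \<Rightarrow> ('b \<Rightarrow> 'b) \<Rightarrow> ('a \<Rightarrow> 'b) \<Rightarrow> bool" where
  "jb_star_inclusion scaleJ jprod starJ S scaleA starA f \<longleftrightarrow>
     (\<forall>x\<in>S. \<forall>y\<in>S. f (x + y) = f x + f y) \<and>
     (\<forall>k. \<forall>x\<in>S. f (scaleJ k x) = scaleA k (f x)) \<and>
     (\<forall>x\<in>S. \<forall>y\<in>S. f (jprod x y) = jordan_product (f x) (f y)) \<and>
     (\<forall>x\<in>S. f (starJ x) = starA (f x)) \<and>
     (\<forall>x\<in>S. norm (f x) = norm x) \<and>
     jb_star_subalgebra scaleA jordan_product starA (f ` S)"

end

theory Submission
  imports Defs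
begin

text \<open>
  Write \<open>d = a * b - b * a\<close>. In an associative algebra the failure of \<open>a\<close> and \<open>b\<close> to operator
  commute at \<open>c\<close> is a quarter of the double commutator \<open>[c, d]\<close>, so \<open>a\<close> and \<open>b\<close> operator commute
  in \<open>J\<close> exactly when \<open>d\<close> commutes with all of \<open>J\<close>. One direction of the equivalence is immediate
  from this. For the other, \<open>J\<close> contains \<open>a\<close>, \<open>b\<close> and their adjoints, and \<open>d\<close> commutes with all four
  of them. This has two consequences that exclude each other unless \<open>d = 0\<close>:

  \<^item> \<open>d\<close> commutes with \<open>a\<close> and \<open>b\<close>, so the commutator with \<open>a\<close>, applied \<open>n\<close> times to \<open>b\<^sup>n d\<close>, yields
    \<open>n! d\<^sup>n d\<close>. Hence \<open>n! \<parallel>d\<^sup>n d\<parallel> \<le> (2 \<parallel>a\<parallel> \<parallel>b\<parallel>)\<^sup>n \<parallel>d\<parallel>\<close>, which is the Kleinecke--Shirokov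
    theorem: \<open>d\<close> is quasinilpotent (lemma \<open>fact_norm_commutator_power_le\<close>).
  \<^item> \<open>d\<close> commutes with the adjoints of \<open>a\<close> and \<open>b\<close>, hence with its own adjoint. For a normal element
    the C*-identity gives \<open>\<parallel>d\<^sup>n d\<parallel> \<ge> \<parallel>d\<parallel>\<^sup>n \<parallel>d\<parallel>\<close> (lemma \<open>norm_power_normal_ge\<close>).

  The first part of the theorem reduces to this, because operator commutation in the Jordan algebra
  is inherited by the subalgebra generated by \<open>a\<close> and \<open>b\<close> and is transported by the inclusion \<open>f\<close>.

  The algebra need not have a unit, so the products \<open>x\<^sup>n y\<close> are expressed as iterates of left
  multiplication by \<open>x\<close>.
\<close>

lemma jordan_associator_eq_double_commutator:
  fixes a b c :: "'a::real_algebra"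
  shows "4 *\<^sub>R (jordan_product (jordan_product a c) b - jordan_product a (jordan_product c b))
    = c * (a * b - b * a) - (a * b - b * a) * c"
  by (simp add: jordan_product_def algebra_simps)

lemma operator_commute_in_iff_commutator_commutes:
  fixes a b :: "'a::real_algebra"
  shows "operator_commute_in J jordan_product a b
    \<longleftrightarrow> (\<forall>c\<in>J. c * (a * b - b * a) = (a * b - b * a) * c)"
proof -
  have "jordan_product (jordan_product a c) b = jordan_product a (jordan_product c b)
    \<longleftrightarrow> c * (a * b - b * a) = (a * b - b * a) * c" for c
    using jordan_associator_eq_double_commutator[of a c b] by (metis eq_iff_diff_eq_0
        scaleR_eq_0_iff zero_neq_numeral)
  then show ?thesis
    by (simp add: operator_commute_in_def)
qed

section \<open>Commutators that commute with their entries are quasinilpotent\<close>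

lemma norm_iterate_le:
  fixes F :: "'a::real_normed_vector \<Rightarrow> 'a"
  assumes "\<And>x. norm (F x) \<le> C * norm x" and "0 \<le> C"
  shows "norm ((F ^^ n) x) \<le> C ^ n * norm x"
proof (induction n)
  case (Suc n)
  have "norm ((F ^^ Suc n) x) \<le> C * norm ((F ^^ n) x)"
    using assms(1) by simp
  also have "\<dots> \<le> C * (C ^ n * norm x)"
    by (rule mult_left_mono[OF Suc assms(2)])
  finally show ?case by (simp add: mult.assoc)
qed simp

text \<open>
  By the Leibniz rule, commutation with \<open>a\<close> acts on \<open>b\<^sup>n x\<close> like \<open>d\<close> times differentiation with
  respect to \<open>b\<close>.
\<close>

lemma commutator_power:
  fixes a b d x :: "'a::real_normed_algebra"
  assumes d: "d = a * b - b * a" and db: "b * d = d * b" and xa: "a * x = x * a"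
  shows "a * ((*) b ^^ Suc n) x - ((*) b ^^ Suc n) x * a = real (Suc n) *\<^sub>R (d * ((*) b ^^ n) x)"
proof (induction n)
  case 0
  show ?case
    using xa by (simp add: d algebra_simps)
next
  case (Suc n)
  let ?y = "((*) b ^^ Suc n) x" and ?z = "((*) b ^^ n) x"
  have "a * (b * ?y) - (b * ?y) * a = d * ?y + b * (a * ?y - ?y * a)"
    by (simp add: d algebra_simps)
  also have "b * (a * ?y - ?y * a) = real (Suc n) *\<^sub>R (d * ?y)"
    by (simp only: Suc mult_scaleR_right mult.assoc[symmetric] db) (simp add: mult.assoc)
  also have "d * ?y + \<dots> = (1 + real (Suc n)) *\<^sub>R (d * ?y)"
    by (simp only: scaleR_left_distrib scaleR_one)
  finally show ?case
    by simp
qed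

text \<open>
  The product is seeded with \<open>d\<close>, which takes the place of the unit: the commutator with \<open>a\<close> kills
  it, so each application only differentiates the power of \<open>b\<close>.
\<close>

lemma iterated_commutator_power:
  fixes a b d :: "'a::real_normed_algebra"
  assumes d: "d = a * b - b * a" and da: "a * d = d * a" and db: "b * d = d * b"
  shows "((\<lambda>x. a * x - x * a) ^^ n) (((*) b ^^ n) d) = fact n *\<^sub>R ((*) d ^^ n) d"
proof (induction n)
  case (Suc n)
  let ?D = "\<lambda>x. a * x - x * a"
  have out: "(?D ^^ m) (r *\<^sub>R (d * x)) = r *\<^sub>R (d * (?D ^^ m) x)" for m r x
  proof (induction m)
    case (Suc m)
    have "a * (d * y) = d * (a * y)" for y
      by (metis da mult.assoc)
    with Suc show ?case
      by (simp add: algebra_simps)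
  qed simp
  have "(?D ^^ Suc n) (((*) b ^^ Suc n) d) = (?D ^^ n) (?D (((*) b ^^ Suc n) d))"
    by (simp only: funpow_Suc_right o_apply)
  also have "?D (((*) b ^^ Suc n) d) = real (Suc n) *\<^sub>R (d * ((*) b ^^ n) d)"
    using commutator_power[OF d db da] by blast
  also have "(?D ^^ n) \<dots> = real (Suc n) *\<^sub>R (d * (?D ^^ n) (((*) b ^^ n) d))"
    by (rule out)
  finally show ?case
    by (simp add: Suc.IH)
qed simp

lemma fact_norm_commutator_power_le:
  fixes a b d :: "'a::real_normed_algebra"
  assumes "d = a * b - b * a" "a * d = d * a" "b * d = d * b"
  shows "fact n * norm (((*) d ^^ n) d) \<le> (2 * norm a * norm b) ^ n * norm d"
proof -
  let ?D = "\<lambda>x. a * x - x * a"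
  have "norm (?D x) \<le> (2 * norm a) * norm x" for x
    using norm_triangle_ineq4[of "a * x" "x * a"] norm_mult_ineq[of a x] norm_mult_ineq[of x a]
    by (simp add: algebra_simps)
  then have "norm ((?D ^^ n) (((*) b ^^ n) d)) \<le> (2 * norm a) ^ n * norm (((*) b ^^ n) d)"
    by (rule norm_iterate_le) simp
  also have "\<dots> \<le> (2 * norm a) ^ n * (norm b ^ n * norm d)"
    by (intro mult_left_mono norm_iterate_le norm_mult_ineq) auto
  finally show ?thesis
    unfolding iterated_commutator_power[OF assms] by (simp add: power_mult_distrib mult.assoc)
qed

section \<open>Normal elements\<close>

context c_star_algebra
begin

lemma star_diff: "star (x - y) = star x - star y"
  using star_add[of "x - y" y] by (simp add: algebra_simps)

lemma norm_mult_normal: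
  assumes "star d * d = d * star d"
  shows "norm (d * y) = norm (star d * y)"
proof -
  have "star (d * y) * (d * y) = star y * (star d * d) * y"
    by (simp add: star_mult mult.assoc)
  also have "\<dots> = star (star d * y) * (star d * y)"
    unfolding assms by (simp add: star_mult star_star mult.assoc)
  finally have "(norm (d * y))\<^sup>2 = (norm (star d * y))\<^sup>2"
    by (metis norm_star_mult_self)
  then show ?thesis by simp
qed

text \<open>
  The norms of \<open>x\<close>, \<open>d x\<close>, \<open>d\<^sup>2 x\<close>, \<open>\<dots>\<close> form a log-convex sequence, since the C*-identity turns
  \<open>\<parallel>d x\<parallel>\<^sup>2\<close> into the norm of a product of the adjoint of \<open>x\<close> and an element of norm \<open>\<parallel>d\<^sup>2 x\<parallel>\<close>.
\<close>

lemma norm_mult_normal_log_convex: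
  assumes "star d * d = d * star d"
  shows "(norm (d * x))\<^sup>2 \<le> norm x * norm (d * (d * x))"
proof -
  have "(norm (d * x))\<^sup>2 = norm (star x * (star d * (d * x)))"
    by (simp add: norm_star_mult_self[symmetric] star_mult mult.assoc)
  also have "\<dots> \<le> norm (star x) * norm (star d * (d * x))"
    by (rule norm_mult_ineq)
  finally show ?thesis
    by (simp add: norm_star norm_mult_normal[OF assms])
qed

text \<open>
  Log-convexity makes the ratios of consecutive terms increase, and the first ratio is \<open>\<parallel>d\<parallel>\<close>.
\<close>

lemma norm_power_normal_ge:
  assumes normal: "star d * d = d * star d"
  shows "norm d ^ n * norm d \<le> norm (((*) d ^^ n) d)"
proof -
  let ?s = "\<lambda>n. norm (((*) d ^^ n) d)"
  have ratio: "norm d * ?s n \<le> ?s (Suc n)" for n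
  proof (induction n)
    case 0
    show ?case
      using norm_mult_normal[OF normal, of d] norm_star_mult_self[of d]
      by (simp add: power2_eq_square)
  next
    case (Suc n)
    show ?case
    proof (cases "?s n = 0")
      case True
      then show ?thesis by simp
    next
      case False
      have "?s n * (norm d * ?s (Suc n)) = (norm d * ?s n) * ?s (Suc n)"
        by simp
      also have "\<dots> \<le> ?s (Suc n) * ?s (Suc n)"
        by (rule mult_right_mono[OF Suc]) simp
      also have "\<dots> \<le> ?s n * ?s (Suc (Suc n))"
        using norm_mult_normal_log_convex[OF normal, of "((*) d ^^ n) d"]
        by (simp add: power2_eq_square)
      finally show ?thesis
        using False by (simp only: mult_le_cancel_left_pos zero_less_norm_iff norm_eq_zero
            not_False_eq_True)
    qed
  qed
  show ?thesis
  proof (induction n)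
    case (Suc n)
    have "norm d * (norm d ^ n * norm d) \<le> norm d * ?s n"
      by (rule mult_left_mono[OF Suc]) simp
    with ratio[of n] show ?case by (simp add: mult.assoc)
  qed simp
qed

section \<open>Operator commutation and commutation\<close>

text \<open>
  The factorial wins: the two estimates together give \<open>1 \<le> C\<^sup>n / n!\<close> for a fixed \<open>C\<close> and all \<open>n\<close>.
\<close>

lemma normal_commutator_eq_0:
  assumes d: "d = a * b - b * a" and da: "a * d = d * a" and db: "b * d = d * b"
    and normal: "star d * d = d * star d"
  shows "d = 0"
proof (rule ccontr)
  assume "d \<noteq> 0"
  then have pos: "0 < norm d" by simp
  let ?C = "2 * norm a * norm b"
  have "1 \<le> (?C / norm d) ^ n / fact n" for n
  proof -
    have "fact n * (norm d ^ n * norm d) \<le> fact n * norm (((*) d ^^ n) d)"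
      by (rule mult_left_mono[OF norm_power_normal_ge[OF normal]]) simp
    also have "\<dots> \<le> ?C ^ n * norm d"
      by (rule fact_norm_commutator_power_le[OF d da db])
    finally have "fact n * norm d ^ n \<le> ?C ^ n"
      using pos by (simp add: mult.assoc[symmetric])
    then show ?thesis
      using pos by (simp add: power_divide field_simps)
  qed
  moreover have "(\<lambda>n. (?C / norm d) ^ n / fact n) \<longlonglongrightarrow> 0"
    using summable_LIMSEQ_zero[OF summable_exp[of "?C / norm d"]]
    by (simp add: divide_inverse mult.commute)
  ultimately have "(1::real) \<le> 0"
    by (meson LIMSEQ_le_const)
  then show False by simp
qed

lemma operator_commute_imp_commute:
  assumes J: "\<And>x. x \<in> J \<Longrightarrow> star x \<in> J" and a: "a \<in> J" and b: "b \<in> J"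
    and oc: "operator_commute_in J jordan_product a b"
  shows "a * b = b * a"
proof -
  define d where "d = a * b - b * a"
  have comm: "c * d = d * c" if "c \<in> J" for c
    using oc that unfolding operator_commute_in_iff_commutator_commutes d_def by blast
  have star_d: "star d = star b * star a - star a * star b"
    by (simp add: d_def star_diff star_mult)
  have prod: "(star x * star y) * d = d * (star x * star y)" if "x \<in> J" "y \<in> J" for x y
    using comm[OF J[OF that(1)]] comm[OF J[OF that(2)]] by (metis mult.assoc)
  have "star d * d = d * star d"
    unfolding star_d left_diff_distrib right_diff_distrib using prod a b by simp
  from normal_commutator_eq_0[OF d_def comm[OF a] comm[OF b] this] show ?thesis
    by (simp add: d_def)
qed

lemma operator_commute_iff_commute:
  assumes "\<And>x. x \<in> J \<Longrightarrow> star x \<in> J" and "a \<in> J" and "b \<in> J"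
  shows "operator_commute_in J jordan_product a b \<longleftrightarrow> a * b = b * a"
  using operator_commute_imp_commute[OF assms]
  by (auto simp: operator_commute_in_iff_commutator_commutes)

end

lemma jb_star_subalgebra_hull_jprod:
  assumes "x \<in> jb_star_subalgebra scaleC jprod star hull X"
    and "y \<in> jb_star_subalgebra scaleC jprod star hull X"
  shows "jprod x y \<in> jb_star_subalgebra scaleC jprod star hull X"
  using assms unfolding hull_def jb_star_subalgebra_def by blast

lemma operator_commute_in_image:
  assumes incl: "jb_star_inclusion scaleJ jprod starJ S scaleA starA f"
    and closed: "\<And>x y. x \<in> S \<Longrightarrow> y \<in> S \<Longrightarrow> jprod x y \<in> S"
    and S: "a \<in> S" "b \<in> S" and oc: "operator_commute_in S jprod a b"
  shows "operator_commute_in (f ` S) jordan_product (f a) (f b)"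
  unfolding operator_commute_in_def
proof (intro ballI, elim imageE)
  fix y c
  assume y: "y = f c" and c: "c \<in> S"
  have f: "jordan_product (f u) (f v) = f (jprod u v)" if "u \<in> S" "v \<in> S" for u v
    using incl that by (simp add: jb_star_inclusion_def)
  show "jordan_product (jordan_product (f a) y) (f b)
      = jordan_product (f a) (jordan_product y (f b))"
    using oc c S closed by (simp add: y f operator_commute_in_def)
qed

theorem proposition1p2:
  fixes scaleJ :: "complex \<Rightarrow> 'a::banach \<Rightarrow> 'a"
    and jprod :: "'a \<Rightarrow> 'a \<Rightarrow> 'a"
    and starJ :: "'a \<Rightarrow> 'a"
    and scaleA :: "complex \<Rightarrow> 'b::{banach, real_normed_algebra} \<Rightarrow> 'b"
    and starA :: "'b \<Rightarrow> 'b"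
  assumes "c_star_algebra scaleA starA"
  shows "(jb_star_algebra scaleJ jprod starJ \<longrightarrow> (\<forall>a b f.
            jb_star_inclusion scaleJ jprod starJ
              (jb_star_subalgebra scaleJ jprod starJ hull {a, b}) scaleA starA f \<longrightarrow>
            operator_commute_in UNIV jprod a b \<longrightarrow>
            f a * f b = f b * f a)) \<and>
         (\<forall>J. jb_star_subalgebra scaleA jordan_product starA J \<longrightarrow>
            (\<forall>a\<in>J. \<forall>b\<in>J.
               operator_commute_in J jordan_product a b \<longleftrightarrow> a * b = b * a))"
proof (intro conjI impI allI ballI)
  interpret A: c_star_algebra scaleA starA by fact
  {
    fix a b f
    let ?S = "jb_star_subalgebra scaleJ jprod starJ hull {a, b}"
    assume incl: "jb_star_inclusion scaleJ jprod starJ ?S scaleA starA f"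
      and oc: "operator_commute_in UNIV jprod a b"
    have ab: "a \<in> ?S" "b \<in> ?S"
      using hull_subset[of "{a, b}" "jb_star_subalgebra scaleJ jprod starJ"] by auto
    have "operator_commute_in ?S jprod a b"
      using oc by (simp add: operator_commute_in_def)
    from operator_commute_in_image[OF incl jb_star_subalgebra_hull_jprod ab this]
    have "operator_commute_in (f ` ?S) jordan_product (f a) (f b)" .
    moreover have "starA x \<in> f ` ?S" if "x \<in> f ` ?S" for x
      using incl that unfolding jb_star_inclusion_def jb_star_subalgebra_def by blast
    ultimately show "f a * f b = f b * f a"
      using A.operator_commute_imp_commute ab by blast
  next
    fix J a b
    assume "jb_star_subalgebra scaleA jordan_product starA J" "a \<in> J" "b \<in> J"
    then show "operator_commute_in J jordan_product a b \<longleftrightarrow> a * b = b * a"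
      by (intro A.operator_commute_iff_commute) (simp_all add: jb_star_subalgebra_def)
  }
qed

end
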